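(* Let $X$ be an arbitrary finite or infinite set, and let $\mathscr{F}$ be the set of Hamming balls of radius $t$ inside the $n$-dimensional space $X^n$. Then the colorful Helly number of $\mathscr{F}$ is $$\eta(X^n,\mathscr{F})=2^{t+1}.$$
   Context: The Hamming distance $\mathrm{dist}(p,q)$ between $p,q\in X^n$ is the number of coordinates where $p$ and $q$ differ. The Hamming ball centered at $x\in X^n$ with radius $t$ is the set $B(x,t)$ of points $y\in X^n$ with $\mathrm{dist}(x,y)\le t$. For a set $Y$ and a family $\mathscr{F}$ of subsets of $Y$, the colorful Helly number $\eta(Y,\mathscr{F})$ is the minimum positive integer $\eta$ for which the following holds: if finite subfamilies $\mathscr{F}_1,\ldots,\mathscr{F}_\eta\subset\mathscr{F}$ are such that $\bigcap_{F\in\mathscr{F}_i}F=\emptyset$ for every $i=1,\ldots,\eta$, then there exist $F_i\in\mathscr{F}_i$ ($1\le i\le\eta$) such that $F_1\cap\cdots\cap F_\eta=\emptyset$. If no such integer exists, $\eta(Y,\mathscr{F})=\infty$.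
   Formalization: The formal theorem assumes that X has at least two elements and that t < n; otherwise the formula fails: if |X| = 1, or t ≥ n, every ball is all of X^n and η = 1, and if X is empty with n > 0 then η = ∞. *)

theory Defs
  imports "HOL-Library.FuncSet" "HOL-Library.Extended_Nat"
begin

definition hamming_space :: "nat \<Rightarrow> 'a set \<Rightarrow> (nat \<Rightarrow> 'a) set" where
  "hamming_space n X = ({..<n} \<rightarrow>\<^sub>E X)"

definition hamming_dist :: "nat \<Rightarrow> (nat \<Rightarrow> 'a) \<Rightarrow> (nat \<Rightarrow> 'a) \<Rightarrow> nat" where
  "hamming_dist n p q = card {i. i < n \<and> p i \<noteq> q i}"

definition hamming_ball :: "nat \<Rightarrow> 'a set \<Rightarrow> (nat \<Rightarrow> 'a) \<Rightarrow> nat \<Rightarrow> (nat \<Rightarrow> 'a) set" where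
  "hamming_ball n X x t = {y \<in> hamming_space n X. hamming_dist n x y \<le> t}"

definition hamming_balls :: "nat \<Rightarrow> 'a set \<Rightarrow> nat \<Rightarrow> (nat \<Rightarrow> 'a) set set" where
  "hamming_balls n X t = (\<lambda>x. hamming_ball n X x t) ` hamming_space n X"

(* Intersections are taken inside Y, so the intersection of an empty subfamily is Y, not UNIV. *)
definition colorful_helly_property :: "'b set \<Rightarrow> 'b set set \<Rightarrow> nat \<Rightarrow> bool" where
  "colorful_helly_property Y \<F> k \<longleftrightarrow>
    (\<forall>\<G> :: nat \<Rightarrow> 'b set set.
      (\<forall>i\<in>{1..k}. finite (\<G> i) \<and> \<G> i \<subseteq> \<F> \<and> Y \<inter> \<Inter>(\<G> i) = {}) \<longrightarrow>
      (\<exists>F :: nat \<Rightarrow> 'b set. (\<forall>i\<in>{1..k}. F i \<in> \<G> i) \<and> Y \<inter> (\<Inter>i\<in>{1..k}. F i) = {}))"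

definition colorful_helly_number :: "'b set \<Rightarrow> 'b set set \<Rightarrow> enat" where
  "colorful_helly_number Y \<F> =
    (if \<exists>k>0. colorful_helly_property Y \<F> k
     then enat (LEAST k. k > 0 \<and> colorful_helly_property Y \<F> k)
     else \<infinity>)"

end

theory Submission
  imports Defs "HOL-Computational_Algebra.Polynomial" "HOL-Library.Z2"
begin

text \<open>
  The upper bound rests on a skew set-pair inequality: if \<open>dist(a\<^sub>i, b\<^sub>i) > t\<close> for all
  \<open>i\<close> and \<open>dist(a\<^sub>i, b\<^sub>j) \<le> t\<close> for \<open>i < j\<close>, then there are at most
  \<open>2^(t+1)\<close> pairs, whatever \<open>n\<close> and \<open>X\<close> are (\<open>skew_hamming_pairs_bound\<close>). If no
  colour class of balls has a common point but every choice of representatives does, such pairs arise greedily: let \<open>b\<^sub>i\<close> be a common point of the balls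
  chosen so far, and let \<open>a\<^sub>i\<close> be the centre of a ball of the next colour that misses
  \<open>b\<^sub>i\<close>. After \<open>2^(t+1)\<close> colours the chosen balls still have a common point, and any
  colour, say the first, supplies one more pair, which is one too many.

  The inequality follows from a function \<open>M(a, b)\<close> that vanishes when
  \<open>dist(a, b) \<le> t\<close>, is nonzero on the given pairs, and has rank at most
  \<open>2^(t+1)\<close> as a matrix: the matrix \<open>M(a\<^sub>i, b\<^sub>j)\<close> is then triangular with nonzero
  diagonal. To obtain it, embed the finitely many symbols that occur into an infinite integral
  domain \<open>K\<close> of characteristic two, and work in the commutative algebra
  \<open>K[\<theta>\<^sub>1, \<dots>, \<theta>\<^sub>d]/(\<theta>\<^sub>l\<^sup>2)\<close> with \<open>d = t + 1\<close>, which is free of rank \<open>2^d\<close>. Every linear form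
  \<open>\<nu>\<^sub>c = \<Sum>\<^sub>l y\<^sub>c^l \<theta>\<^sub>l\<close> squares to zero there, since the mixed terms occur twice.
  Hence the element \<open>v(z) = \<Prod>\<^sub>c (1 + z\<^sub>c \<nu>\<^sub>c)\<close> satisfies \<open>v(a + b) = v(a) v(b)\<close>
  (\<open>moment_vector_add\<close>). Let \<open>M(a, b)\<close> be the coefficient of
  \<open>\<theta>\<^sub>1 \<dots> \<theta>\<^sub>d\<close> in \<open>v(a + b)\<close>. Multiplicativity writes it as a sum of
  \<open>2^d\<close> products, one for each subset of the variables; this is the rank bound. Only
  coordinates with \<open>a\<^sub>c + b\<^sub>c \<noteq> 0\<close>, that is \<open>a\<^sub>c \<noteq> b\<^sub>c\<close>, contribute a
  factor of positive degree, so degree \<open>d\<close> cannot be reached with fewer than \<open>d\<close> of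
  them (\<open>moment_vector_low_weight\<close>), while for generic \<open>y\<close> it is reached with a nonzero
  coefficient otherwise (\<open>exists_generic_points\<close>).

  For the lower bound let every colour class consist of the balls centred at the vertices of a
  \<open>(t+1)\<close>-dimensional subcube. No point lies in all of them, because some vertex differs from
  it in all \<open>t + 1\<close> coordinates. But a selection of fewer than \<open>2^(t+1)\<close> of the balls
  omits that of some vertex, and the antipode of this vertex lies within \<open>t\<close> of every other vertex.
\<close>

section \<open>Linear dependence over integral domains\<close>

text \<open>Elimination without division: a pivot \<open>p\<close> clears the column \<open>s\<close> after cross-multiplication,
  so an integral domain is as good as a field here.\<close>

lemma exists_linear_dependence:
  fixes A :: "'i \<Rightarrow> 's \<Rightarrow> 'k::idom"
  assumes "finite S" "finite I" "card S < card I"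
  shows "\<exists>c. (\<exists>i\<in>I. c i \<noteq> 0) \<and> (\<forall>s\<in>S. (\<Sum>i\<in>I. c i * A i s) = 0)"
  using assms
proof (induction S arbitrary: I A rule: finite_induct)
  case empty
  then have "I \<noteq> {}" by auto
  then show ?case by (intro exI[of _ "\<lambda>_. 1"]) auto
next
  case (insert s S)
  show ?case
  proof (cases "\<forall>i\<in>I. A i s = 0")
    case True
    obtain c where "\<exists>i\<in>I. c i \<noteq> 0" "\<forall>s\<in>S. (\<Sum>i\<in>I. c i * A i s) = 0"
      using insert.IH[of I A] insert.prems insert.hyps by auto
    then show ?thesis using True by (intro exI[of _ c]) auto
  next
    case False
    then obtain p where p: "p \<in> I" "A p s \<noteq> 0" by auto
    let ?J = "I - {p}"
    have "card S < card ?J" using insert.prems insert.hyps p by auto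
    then obtain c where c: "\<exists>i\<in>?J. c i \<noteq> 0"
      and z: "\<forall>u\<in>S. (\<Sum>i\<in>?J. c i * (A p s * A i u - A i s * A p u)) = 0"
      using insert.IH[of ?J "\<lambda>i u. A p s * A i u - A i s * A p u"] insert.prems by auto
    \<comment> \<open>The coefficient of the pivot is what makes the column of \<open>s\<close> vanish.\<close>
    define d where "d i = (if i = p then - (\<Sum>j\<in>?J. c j * A j s) else A p s * c i)" for i
    have split: "(\<Sum>i\<in>I. d i * A i u)
        = (\<Sum>i\<in>?J. c i * (A p s * A i u - A i s * A p u))" for u
    proof -
      have "(\<Sum>i\<in>I. d i * A i u) = d p * A p u + (\<Sum>i\<in>?J. d i * A i u)"
        using p insert.prems by (simp add: sum.remove)
      also have "(\<Sum>i\<in>?J. d i * A i u) = (\<Sum>i\<in>?J. A p s * c i * A i u)"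
        by (rule sum.cong) (auto simp: d_def)
      also have "d p * A p u = - (\<Sum>j\<in>?J. c j * A j s * A p u)"
        by (simp add: d_def sum_distrib_right)
      finally show ?thesis
        by (simp add: sum_subtractf algebra_simps)
    qed
    have "(\<Sum>i\<in>I. d i * A i u) = 0" if "u \<in> insert s S" for u
      using that z unfolding split by auto
    moreover have "\<exists>i\<in>I. d i \<noteq> 0"
      using c p by (auto simp: d_def)
    ultimately show ?thesis by blast
  qed
qed

text \<open>In a vanishing combination of the rows of a lower triangular matrix, the column of the last
  row that occurs meets no other row of the combination, which contradicts the nonzero diagonal.\<close>

lemma skew_triangular_rank:
  fixes P Q :: "nat \<Rightarrow> 's \<Rightarrow> 'k::idom"
  assumes S: "finite S"
    and diag: "\<And>i. i < m \<Longrightarrow> (\<Sum>s\<in>S. P i s * Q i s) \<noteq> 0"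
    and upper: "\<And>i j. i < j \<Longrightarrow> j < m \<Longrightarrow> (\<Sum>s\<in>S. P i s * Q j s) = 0"
  shows "m \<le> card S"
proof (rule ccontr)
  assume "\<not> m \<le> card S"
  then obtain c where nz: "\<exists>i\<in>{..<m}. c i \<noteq> 0"
    and c: "\<forall>s\<in>S. (\<Sum>i<m. c i * P i s) = 0"
    using exists_linear_dependence[OF S, of "{..<m}" P] by auto
  define j where "j = Max {i. i < m \<and> c i \<noteq> 0}"
  have "j \<in> {i. i < m \<and> c i \<noteq> 0}" unfolding j_def by (rule Max_in) (use nz in auto)
  then have j: "j < m" "c j \<noteq> 0" by auto
  have above: "c i = 0" if "j < i" "i < m" for i
  proof (rule ccontr)
    assume "c i \<noteq> 0"
    then have "i \<le> j" unfolding j_def using that by (intro Max_ge) auto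
    then show False using that by simp
  qed
  have "0 = (\<Sum>s\<in>S. (\<Sum>i<m. c i * P i s) * Q j s)"
    using c by simp
  also have "\<dots> = (\<Sum>i<m. c i * (\<Sum>s\<in>S. P i s * Q j s))"
    unfolding sum_distrib_left sum_distrib_right mult.assoc by (rule sum.swap)
  also have "\<dots> = (\<Sum>i<m. if i = j then c j * (\<Sum>s\<in>S. P j s * Q j s) else 0)"
  proof (rule sum.cong)
    fix i assume "i \<in> {..<m}"
    then show "c i * (\<Sum>s\<in>S. P i s * Q j s)
        = (if i = j then c j * (\<Sum>s\<in>S. P j s * Q j s) else 0)"
      using above[of i] upper[of i j] j by (cases i j rule: linorder_cases) simp_all
  qed simp
  also have "\<dots> = c j * (\<Sum>s\<in>S. P j s * Q j s)"
    using j by simp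
  finally show False using j diag by simp
qed

section \<open>A square-free commutative algebra in characteristic two\<close>

text \<open>An element of \<open>K[\<theta>\<^sub>1, \<theta>\<^sub>2, \<dots>]/(\<theta>\<^sub>l\<^sup>2)\<close> is represented by the function that sends a
  finite set \<open>U\<close> to the coefficient of \<open>\<Prod>\<^sub>l\<^sub>\<in>\<^sub>U \<theta>\<^sub>l\<close>. Then \<open>set_conv\<close> is the
  product of the algebra, \<open>mult_point y\<close> is multiplication by \<open>\<Sum>\<^sub>l y^l \<theta>\<^sub>l\<close>, and
  \<open>moment_vector y z n\<close> is \<open>\<Prod>\<^sub>c\<^sub><\<^sub>n (1 + z\<^sub>c \<nu>\<^sub>c)\<close> with
  \<open>\<nu>\<^sub>c = \<Sum>\<^sub>l y\<^sub>c^l \<theta>\<^sub>l\<close>. Taking the coefficient vectors of the \<open>\<nu>\<^sub>c\<close> on the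
  moment curve reduces the later choice of a generic vector to that of one scalar.\<close>

definition set_conv :: "(nat set \<Rightarrow> 'k::comm_ring_1) \<Rightarrow> (nat set \<Rightarrow> 'k) \<Rightarrow> nat set \<Rightarrow> 'k" where
  "set_conv f g U = (\<Sum>S\<in>Pow U. f S * g (U - S))"

definition mult_point :: "'k::comm_ring_1 \<Rightarrow> (nat set \<Rightarrow> 'k) \<Rightarrow> nat set \<Rightarrow> 'k" where
  "mult_point y f U = (\<Sum>l\<in>U. y ^ l * f (U - {l}))"

primrec moment_vector :: "(nat \<Rightarrow> 'k::comm_ring_1) \<Rightarrow> (nat \<Rightarrow> 'k) \<Rightarrow> nat \<Rightarrow> nat set \<Rightarrow> 'k" where
  "moment_vector y z 0 = (\<lambda>U. if U = {} then 1 else 0)"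
| "moment_vector y z (Suc n) =
    (\<lambda>U. moment_vector y z n U + z n * mult_point (y n) (moment_vector y z n) U)"

lemma set_conv_commute: "finite U \<Longrightarrow> set_conv f g U = set_conv g f U"
  unfolding set_conv_def
  by (rule sum.reindex_bij_witness[of _ "\<lambda>S. U - S" "\<lambda>S. U - S"])
     (auto simp: double_diff mult.commute)

lemma set_conv_mult_point_left:
  assumes "finite U"
  shows "set_conv (mult_point y f) g U = mult_point y (set_conv f g) U"
proof -
  have "set_conv (mult_point y f) g U
      = (\<Sum>(S,l)\<in>(SIGMA S:Pow U. S). y ^ l * f (S - {l}) * g (U - S))"
    using assms
    by (simp add: set_conv_def mult_point_def sum_distrib_right sum.Sigma finite_subset)
  also have "\<dots> = (\<Sum>(l,R)\<in>(SIGMA l:U. Pow (U - {l})). y ^ l * (f R * g (U - {l} - R)))"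
    by (rule sum.reindex_bij_witness[of _ "\<lambda>(l,R). (insert l R, l)" "\<lambda>(S,l). (l, S - {l})"])
       (auto simp: insert_absorb mult.assoc intro!: arg_cong[where f=g]
          arg_cong2[where f="(*)"])
  also have "\<dots> = mult_point y (set_conv f g) U"
    using assms by (simp add: set_conv_def mult_point_def sum_distrib_left sum.Sigma)
  finally show ?thesis .
qed

lemma mult_point_cong:
  "(\<And>l. l \<in> U \<Longrightarrow> f (U - {l}) = g (U - {l})) \<Longrightarrow> mult_point y f U = mult_point y g U"
  unfolding mult_point_def by (rule sum.cong) auto

lemma set_conv_mult_point_right:
  assumes "finite U"
  shows "set_conv f (mult_point y g) U = mult_point y (set_conv f g) U"
proof -
  have "set_conv f (mult_point y g) U = mult_point y (set_conv g f) U"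
    using assms by (simp add: set_conv_commute[of U f] set_conv_mult_point_left)
  also have "\<dots> = mult_point y (set_conv f g) U"
    using assms by (intro mult_point_cong) (simp add: set_conv_commute)
  finally show ?thesis .
qed

lemma sum_symmetric_off_diagonal:
  fixes h :: "'i \<Rightarrow> 'i \<Rightarrow> 'k::comm_ring_1"
  assumes char2: "\<And>x::'k. x + x = 0" and "finite U" and sym: "\<And>l m. h l m = h m l"
  shows "(\<Sum>l\<in>U. \<Sum>m\<in>U - {l}. h l m) = 0"
  using \<open>finite U\<close>
proof (induction U rule: finite_induct)
  case empty
  then show ?case by simp
next
  case (insert x U)
  have "(\<Sum>m\<in>insert x U - {l}. h l m) = h l x + (\<Sum>m\<in>U - {l}. h l m)" if "l \<in> U" for l
  proof -
    have "insert x U - {l} = insert x (U - {l})" using that insert.hyps by auto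
    then show ?thesis using insert.hyps by simp
  qed
  moreover have "insert x U - {x} = U" using insert.hyps by auto
  ultimately have "(\<Sum>l\<in>insert x U. \<Sum>m\<in>insert x U - {l}. h l m)
      = (\<Sum>m\<in>U. h x m) + (\<Sum>l\<in>U. h l x)"
    using insert by (simp add: sum.distrib)
  also have "\<dots> = 0" using char2 sym[of x] by simp
  finally show ?case .
qed

text \<open>This is the place where characteristic two is needed: in the square of a linear form the
  monomial \<open>\<theta>\<^sub>l \<theta>\<^sub>m\<close> arises once from \<open>(l, m)\<close> and once from \<open>(m, l)\<close>.\<close>

lemma mult_point_twice:
  fixes f :: "nat set \<Rightarrow> 'k::comm_ring_1"
  assumes char2: "\<And>x::'k. x + x = 0" and "finite U"
  shows "mult_point y (mult_point y f) U = 0"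
proof -
  have "mult_point y (mult_point y f) U
      = (\<Sum>l\<in>U. \<Sum>m\<in>U - {l}. y ^ l * y ^ m * f (U - {l,m}))"
    by (simp add: mult_point_def sum_distrib_left mult.assoc Diff_insert2[symmetric])
  also have "\<dots> = 0"
    by (rule sum_symmetric_off_diagonal[OF char2 \<open>finite U\<close>])
       (simp add: insert_commute mult.commute)
  finally show ?thesis .
qed

text \<open>Coordinatewise this is \<open>(1 + a \<nu>)(1 + b \<nu>) = 1 + (a + b) \<nu>\<close>, which holds because
  \<open>\<nu>\<^sup>2 = 0\<close>. The left-hand side depends on the pair only through \<open>a + b\<close>, while the
  right-hand side separates \<open>a\<close> from \<open>b\<close>.\<close>

lemma moment_vector_add:
  fixes y a b :: "nat \<Rightarrow> 'k::comm_ring_1"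
  assumes char2: "\<And>x::'k. x + x = 0" and "finite U"
  shows "moment_vector y (\<lambda>i. a i + b i) n U
    = set_conv (moment_vector y a n) (moment_vector y b n) U"
  using \<open>finite U\<close>
proof (induction n arbitrary: U)
  case 0
  have "set_conv (moment_vector y a 0) (moment_vector y b 0) U
      = (\<Sum>S\<in>Pow U. if S = {} then (if U = {} then 1 else 0) else 0)"
    unfolding set_conv_def by (rule sum.cong) auto
  then show ?case using 0 by simp
next
  case (Suc n)
  let ?e = "moment_vector y a n" and ?g = "moment_vector y b n"
  let ?D = "mult_point (y n)"
  have IH: "?D (moment_vector y (\<lambda>i. a i + b i) n) U = ?D (set_conv ?e ?g) U"
    using Suc by (intro mult_point_cong) auto
  have "?D (set_conv ?e (?D ?g)) U = ?D (?D (set_conv ?e ?g)) U"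
    using Suc.prems by (intro mult_point_cong) (simp add: set_conv_mult_point_right)
  then have DD: "set_conv (?D ?e) (?D ?g) U = 0"
    using Suc.prems by (simp add: set_conv_mult_point_left mult_point_twice[OF char2])
  have "set_conv (moment_vector y a (Suc n)) (moment_vector y b (Suc n)) U
     = set_conv ?e ?g U + a n * set_conv (?D ?e) ?g U + b n * set_conv ?e (?D ?g) U
        + a n * b n * set_conv (?D ?e) (?D ?g) U"
    by (simp add: set_conv_def sum.distrib sum_distrib_left algebra_simps)
  also have "\<dots> = moment_vector y (\<lambda>i. a i + b i) (Suc n) U"
    using Suc.prems
    by (simp add: DD set_conv_mult_point_left set_conv_mult_point_right IH Suc.IH algebra_simps)
  finally show ?case by simp
qed

section \<open>The top coefficient detects Hamming distance\<close>

abbreviation weight :: "nat \<Rightarrow> (nat \<Rightarrow> 'k::zero) \<Rightarrow> nat" where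
  "weight n z \<equiv> card {i. i < n \<and> z i \<noteq> 0}"

lemma weight_Suc: "weight (Suc n) z = weight n z + (if z n = 0 then 0 else 1)"
proof -
  have "{i. i < Suc n \<and> z i \<noteq> 0} =
      (if z n = 0 then {i. i < n \<and> z i \<noteq> 0} else insert n {i. i < n \<and> z i \<noteq> 0})"
    by (auto simp: less_Suc_eq)
  then show ?thesis by simp
qed

text \<open>Each nonzero coordinate of \<open>z\<close> contributes a factor of degree at most one.\<close>

lemma moment_vector_low_weight:
  assumes "finite U" "weight n z < card U"
  shows "moment_vector y z n U = 0"
  using assms
proof (induction n arbitrary: U)
  case 0
  then show ?case by auto
next
  case (Suc n)
  have "z n * mult_point (y n) (moment_vector y z n) U = 0"
  proof (cases "z n = 0")
    case False
    then have "moment_vector y z n (U - {l}) = 0" if "l \<in> U" for l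
      using Suc that by (auto simp: weight_Suc)
    then show ?thesis by (simp add: mult_point_def)
  qed simp
  then show ?case using Suc by (auto simp: weight_Suc)
qed

lemma moment_vector_cong:
  "(\<And>i. i < n \<Longrightarrow> y i = y' i) \<Longrightarrow> moment_vector y z n = moment_vector y' z n"
  by (induction n) auto

text \<open>The points are chosen one coordinate at a time. As functions of the new point \<open>x\<close>, the
  finitely many coefficients that have to stay nonzero are polynomials. If the weight of \<open>z\<close>
  grows, the polynomial for \<open>U\<close> has the coefficient \<open>z\<^sub>n\<close> times an earlier nonzero value
  at \<open>x^l\<close> for each \<open>l\<close> in \<open>U\<close>. The exponents start at \<open>1\<close> so that these
  terms do not mix with the constant term. All sets \<open>U\<close>, not just the full one, are needed for
  this induction.\<close>

lemma exists_generic_points: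
  fixes Z :: "(nat \<Rightarrow> 'k::idom) set"
  assumes inf: "infinite (UNIV :: 'k set)" and "finite Z"
  shows "\<exists>y. \<forall>z\<in>Z. \<forall>U\<subseteq>{1..d}. card U \<le> weight n z \<longrightarrow> moment_vector y z n U \<noteq> 0"
proof (induction n)
  case 0
  show ?case by (auto dest: finite_subset)
next
  case (Suc n)
  then obtain y where y: "\<And>z U. z \<in> Z \<Longrightarrow> U \<subseteq> {1..d} \<Longrightarrow> card U \<le> weight n z \<Longrightarrow>
      moment_vector y z n U \<noteq> 0" by blast
  define p where "p z U = [:moment_vector y z n U:]
      + (\<Sum>l\<in>U. monom (z n * moment_vector y z n (U - {l})) l)" for z and U :: "nat set"
  have poly_p: "poly (p z U) x = moment_vector y z n U + z n * mult_point x (moment_vector y z n) U"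
    for z U x
    by (simp add: p_def poly_sum poly_monom mult_point_def sum_distrib_left mult_ac)
  have p_nz: "p z U \<noteq> 0" if z: "z \<in> Z" and U: "U \<subseteq> {1..d}" and w: "card U \<le> weight (Suc n) z" for z U
  proof (cases "U = {} \<or> z n = 0")
    case True
    then have "card U \<le> weight n z" using w by (auto simp: weight_Suc)
    then have "moment_vector y z n U \<noteq> 0" using y z U by blast
    moreover have "p z U = [:moment_vector y z n U:]" using True by (auto simp: p_def)
    ultimately show ?thesis by simp
  next
    case False
    then obtain l where l: "l \<in> U" by auto
    have fin: "finite U" using U finite_subset by blast
    have "l > 0" using l U by auto
    then have "coeff (p z U) l = z n * moment_vector y z n (U - {l})"
      using l fin by (simp add: p_def coeff_sum coeff_pCons split: nat.split)
    moreover have "moment_vector y z n (U - {l}) \<noteq> 0"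
      using False w l fin z U by (intro y) (auto simp: weight_Suc)
    ultimately have "coeff (p z U) l \<noteq> 0" using False by simp
    then show ?thesis by auto
  qed
  define R where "R = (\<Union>(z,U)\<in>{(z,U). z \<in> Z \<and> U \<subseteq> {1..d} \<and> card U \<le> weight (Suc n) z}.
      {x. poly (p z U) x = 0})"
  have "finite (Z \<times> Pow {1..d})" using \<open>finite Z\<close> by simp
  then have "finite {(z,U). z \<in> Z \<and> U \<subseteq> {1..d} \<and> card U \<le> weight (Suc n) z}"
    by (rule rev_finite_subset) auto
  then have "finite R" unfolding R_def
    by (rule finite_UN_I) (auto simp: p_nz intro!: poly_roots_finite)
  then obtain x where x: "x \<notin> R" using inf ex_new_if_finite by blast
  let ?y = "y(n := x)"
  have "moment_vector ?y z (Suc n) U \<noteq> 0"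
    if "z \<in> Z" "U \<subseteq> {1..d}" "card U \<le> weight (Suc n) z" for z U
  proof -
    have "moment_vector ?y z n = moment_vector y z n" by (rule moment_vector_cong) simp
    then have "moment_vector ?y z (Suc n) U = poly (p z U) x" by (simp add: poly_p)
    moreover have "poly (p z U) x \<noteq> 0"
      using x that by (auto simp: R_def)
    ultimately show ?thesis by (simp only: not_False_eq_True)
  qed
  then show ?case by blast
qed

lemma bit_poly_char_2: "(p :: bit poly) + p = 0"
  by (rule poly_eqI) (metis add_bit_eq_xor coeff_0 coeff_add xor_self_eq)

lemma infinite_bit_poly: "infinite (UNIV :: bit poly set)"
proof -
  have "inj (\<lambda>k. monom (1::bit) k)"
    by (rule injI) (metis degree_monom_eq one_neq_zero)
  then show ?thesis using finite_subset[OF subset_UNIV] finite_imageD infinite_UNIV_nat by blast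
qed

section \<open>Skew pairs\<close>

text \<open>Polynomials over the two-element field serve as the infinite domain of characteristic two.\<close>

theorem skew_hamming_pairs_bound:
  fixes a b :: "nat \<Rightarrow> nat \<Rightarrow> 'a"
  assumes far: "\<And>i. i < m \<Longrightarrow> t < hamming_dist n (a i) (b i)"
    and near: "\<And>i j. i < j \<Longrightarrow> j < m \<Longrightarrow> hamming_dist n (a i) (b j) \<le> t"
  shows "m \<le> 2 ^ (t + 1)"
proof -
  define Y where "Y = (\<Union>i<m. a i ` {..<n} \<union> b i ` {..<n})"
  have "finite Y" by (auto simp: Y_def)
  obtain B :: "bit poly set" where B: "finite B" "card B = card Y"
    using infinite_arbitrarily_large[OF infinite_bit_poly] by blast
  obtain enc :: "'a \<Rightarrow> bit poly" where enc: "inj_on enc Y"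
    using finite_same_card_bij[OF \<open>finite Y\<close> B(1)] B(2) by (auto simp: bij_betw_def)
  define z where "z i j = (\<lambda>c. enc (a i c) + enc (b j c))" for i j
  have z0: "z i j c \<noteq> 0 \<longleftrightarrow> a i c \<noteq> b j c" if "i < m" "j < m" "c < n" for i j c
  proof -
    have "a i c \<in> Y" "b j c \<in> Y" using that by (auto simp: Y_def)
    then have "enc (a i c) = enc (b j c) \<longleftrightarrow> a i c = b j c" using enc by (auto dest: inj_onD)
    moreover have "p + q = 0 \<longleftrightarrow> p = q" for p q :: "bit poly"
      by (metis add_left_cancel bit_poly_char_2)
    ultimately show ?thesis by (simp add: z_def)
  qed
  have weight_z: "weight n (z i j) = hamming_dist n (a i) (b j)" if "i < m" "j < m" for i j
    unfolding hamming_dist_def using z0[OF that] by (metis (lifting))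
  let ?U = "{1..t+1}"
  have "finite ((\<lambda>i. z i i) ` {..<m})" by simp
  then obtain y where y: "\<And>i U. i < m \<Longrightarrow> U \<subseteq> ?U \<Longrightarrow> card U \<le> weight n (z i i) \<Longrightarrow>
      moment_vector y (z i i) n U \<noteq> 0"
    using exists_generic_points[OF infinite_bit_poly, of "(\<lambda>i. z i i) ` {..<m}" "t+1" n] by blast
  define P where "P i S = moment_vector y (\<lambda>c. enc (a i c)) n S" for i S
  define Q where "Q j S = moment_vector y (\<lambda>c. enc (b j c)) n (?U - S)" for j S
  have PQ: "(\<Sum>S\<in>Pow ?U. P i S * Q j S) = moment_vector y (z i j) n ?U" for i j
    by (simp add: P_def Q_def z_def moment_vector_add[OF bit_poly_char_2] set_conv_def)
  have "m \<le> card (Pow ?U)"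
  proof (rule skew_triangular_rank)
    show "(\<Sum>S\<in>Pow ?U. P i S * Q i S) \<noteq> 0" if "i < m" for i
      unfolding PQ using far[OF that] that by (intro y) (auto simp: weight_z)
    show "(\<Sum>S\<in>Pow ?U. P i S * Q j S) = 0" if "i < j" "j < m" for i j
      unfolding PQ using near[OF that] that
      by (intro moment_vector_low_weight) (auto simp: weight_z)
  qed simp
  then show ?thesis by (simp add: card_Pow)
qed

section \<open>The colorful Helly number\<close>

lemma hamming_space_nonempty: "a \<in> X \<Longrightarrow> hamming_space n X \<noteq> {}"
  by (auto simp: hamming_space_def PiE_eq_empty_iff)

text \<open>One pair more than there are colours is produced: the points \<open>b\<close> are common points of the
  balls chosen before, and a last pair reuses the first colour.\<close>

lemma colorful_helly_upper:
  assumes "a0 \<in> X"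
  shows "colorful_helly_property (hamming_space n X) (hamming_balls n X t) (2 ^ (t + 1))"
  unfolding colorful_helly_property_def
proof (intro allI impI)
  let ?Y = "hamming_space n X" and ?k = "2 ^ (t + 1) :: nat"
  fix \<G> :: "nat \<Rightarrow> (nat \<Rightarrow> 'a) set set"
  assume G: "\<forall>i\<in>{1..?k}. finite (\<G> i) \<and> \<G> i \<subseteq> hamming_balls n X t \<and> ?Y \<inter> \<Inter>(\<G> i) = {}"
  show "\<exists>F. (\<forall>i\<in>{1..?k}. F i \<in> \<G> i) \<and> ?Y \<inter> (\<Inter>i\<in>{1..?k}. F i) = {}"
  proof (rule ccontr)
    assume "\<not> ?thesis"
    then have cover: "?Y \<inter> (\<Inter>i\<in>{1..?k}. F i) \<noteq> {}" if "\<And>i. i \<in> {1..?k} \<Longrightarrow> F i \<in> \<G> i" for F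
      using that by blast
    \<comment> \<open>Pairs are numbered from \<open>0\<close> and colours from \<open>1\<close>; the last pair has colour \<open>1\<close>.\<close>
    define col where "col i = (if i < ?k then Suc i else 1)" for i
    have col: "col i \<in> {1..?k}" for i by (auto simp: col_def)
    have escape: "\<exists>x\<in>?Y. hamming_ball n X x t \<in> \<G> (col i) \<and> t < hamming_dist n x z"
      if "z \<in> ?Y" for z i
    proof -
      have "z \<notin> \<Inter>(\<G> (col i))" using G col that by blast
      then obtain V where "V \<in> \<G> (col i)" "z \<notin> V" by blast
      moreover have "\<G> (col i) \<subseteq> hamming_balls n X t" using G col by blast
      ultimately obtain x where "x \<in> ?Y" "hamming_ball n X x t \<in> \<G> (col i)"
        "z \<notin> hamming_ball n X x t"
        unfolding hamming_balls_def by blast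
      then show ?thesis using that by (auto simp: hamming_ball_def intro!: bexI[of _ x])
    qed
    have "\<exists>a b. (\<forall>i<l. hamming_ball n X (a i) t \<in> \<G> (col i) \<and> t < hamming_dist n (a i) (b i))
        \<and> (\<forall>i j. i < j \<longrightarrow> j < l \<longrightarrow> hamming_dist n (a i) (b j) \<le> t)" if "l \<le> ?k + 1" for l
      using that
    proof (induction l)
      case 0
      then show ?case by simp
    next
      case (Suc l)
      then obtain a b where ab: "\<And>i. i < l \<Longrightarrow> hamming_ball n X (a i) t \<in> \<G> (col i)"
        "\<And>i. i < l \<Longrightarrow> t < hamming_dist n (a i) (b i)"
        "\<And>i j. i < j \<Longrightarrow> j < l \<Longrightarrow> hamming_dist n (a i) (b j) \<le> t" by force
      have "\<G> i \<noteq> {}" if "i \<in> {1..?k}" for i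
        using G that hamming_space_nonempty[OF assms, of n] by force
      then have some: "(SOME V. V \<in> \<G> i) \<in> \<G> i" if "i \<in> {1..?k}" for i
        using that by (simp add: some_in_eq)
      define F where "F i = (if i \<le> l then hamming_ball n X (a (i - 1)) t else SOME V. V \<in> \<G> i)" for i
      have "F i \<in> \<G> i" if i: "i \<in> {1..?k}" for i
      proof (cases "i \<le> l")
        case True
        then have "col (i - 1) = i" using i by (auto simp: col_def)
        moreover have "i - 1 < l" using True i by auto
        ultimately show ?thesis using ab(1)[of "i - 1"] True by (simp add: F_def)
      next
        case False
        then show ?thesis using some[OF i] by (simp add: F_def)
      qed
      then obtain z where z: "z \<in> ?Y" "\<And>i. i \<in> {1..?k} \<Longrightarrow> z \<in> F i"
        using cover[of F] by blast
      have near: "hamming_dist n (a i) z \<le> t" if "i < l" for i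
      proof -
        have "z \<in> F (Suc i)" using z(2) that Suc.prems by auto
        then show ?thesis using that by (simp add: F_def hamming_ball_def)
      qed
      obtain x where x: "hamming_ball n X x t \<in> \<G> (col l)" "t < hamming_dist n x z"
        using escape[OF z(1)] by blast
      show ?case
        using ab near x
        by (intro exI[of _ "a(l := x)"] exI[of _ "b(l := z)"]) (auto simp: less_Suc_eq)
    qed
    from this[OF order_refl] obtain a b where
      far: "\<forall>i<?k + 1. hamming_ball n X (a i) t \<in> \<G> (col i) \<and> t < hamming_dist n (a i) (b i)"
      and near: "\<forall>i j. i < j \<longrightarrow> j < ?k + 1 \<longrightarrow> hamming_dist n (a i) (b j) \<le> t"
      by (elim exE conjE) (rule that)
    have "?k + 1 \<le> 2 ^ (t + 1)"
      by (rule skew_hamming_pairs_bound[of _ t n a b]) (use far near in blast)+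
    then show False by simp
  qed
qed

lemma colorful_helly_lower:
  assumes pq: "p \<in> X" "q \<in> X" "p \<noteq> q" and "t < n"
    and k: "colorful_helly_property (hamming_space n X) (hamming_balls n X t) k"
  shows "2 ^ (t + 1) \<le> k"
proof (rule ccontr)
  assume "\<not> 2 ^ (t + 1) \<le> k"
  let ?Y = "hamming_space n X"
  define vertex where "vertex A = (\<lambda>i. if i < n then (if i \<in> A then q else p) else undefined)"
    for A :: "nat set"
  have vertex: "vertex A \<in> ?Y" for A
    using pq by (auto simp: vertex_def hamming_space_def split: if_splits)
  define \<C> where "\<C> = (\<lambda>A. hamming_ball n X (vertex A) t) ` Pow {..t}"
  have "?Y \<inter> \<Inter>\<C> = {}"
  proof -
    have "\<exists>V\<in>\<C>. z \<notin> V" for z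
    proof -
      define A where "A = {i. i \<le> t \<and> z i = p}"
      have "{..t} \<subseteq> {i. i < n \<and> vertex A i \<noteq> z i}"
        using \<open>t < n\<close> pq by (auto simp: vertex_def A_def)
      then have "card {..t} \<le> hamming_dist n (vertex A) z"
        unfolding hamming_dist_def by (intro card_mono) auto
      then have "z \<notin> hamming_ball n X (vertex A) t" by (simp add: hamming_ball_def)
      then show ?thesis unfolding \<C>_def A_def by blast
    qed
    then show ?thesis by blast
  qed
  moreover have "finite \<C>" "\<C> \<subseteq> hamming_balls n X t"
    using vertex by (auto simp: \<C>_def hamming_balls_def)
  ultimately obtain F where F: "\<And>i. i \<in> {1..k} \<Longrightarrow> F i \<in> \<C>" "?Y \<inter> (\<Inter>i\<in>{1..k}. F i) = {}"
    using k[unfolded colorful_helly_property_def, rule_format, of "\<lambda>_. \<C>"] by blast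
  have "\<forall>i\<in>{1..k}. \<exists>A\<subseteq>{..t}. F i = hamming_ball n X (vertex A) t"
    using F(1) unfolding \<C>_def by blast
  then obtain C where C: "\<And>i. i \<in> {1..k} \<Longrightarrow> C i \<subseteq> {..t}"
    "\<And>i. i \<in> {1..k} \<Longrightarrow> F i = hamming_ball n X (vertex (C i)) t" by metis
  have "card (C ` {1..k}) \<le> k" using card_image_le[of "{1..k}" C] by simp
  also have "k < card (Pow {..t})" using \<open>\<not> 2 ^ (t + 1) \<le> k\<close> by (simp add: card_Pow)
  finally have "\<not> Pow {..t} \<subseteq> C ` {1..k}" using card_mono[of "C ` {1..k}" "Pow {..t}"] by auto
  then obtain A where A: "A \<subseteq> {..t}" "A \<notin> C ` {1..k}" by blast
  \<comment> \<open>The antipode of a vertex whose ball was not selected.\<close>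
  let ?v = "vertex ({..t} - A)"
  have "?v \<in> F i" if i: "i \<in> {1..k}" for i
  proof -
    have "C i \<noteq> A" using A i by blast
    then obtain j where j: "j \<le> t" "j \<in> C i \<longleftrightarrow> j \<notin> A" using C(1)[OF i] A(1) by blast
    have "{c. c < n \<and> vertex (C i) c \<noteq> ?v c} \<subseteq> {..t} - {j}"
      using C(1)[OF i] A(1) j by (auto simp: vertex_def split: if_splits)
    then have "hamming_dist n (vertex (C i)) ?v \<le> card ({..t} - {j})"
      unfolding hamming_dist_def by (intro card_mono) auto
    also have "\<dots> = t" using j by simp
    finally show ?thesis using C(2)[OF i] vertex by (simp add: hamming_ball_def)
  qed
  then show False using F(2) vertex by blast
qed

theorem mainTheorem8:
  fixes X :: "'a set" and n t :: nat
  assumes "\<exists>a\<in>X. \<exists>b\<in>X. a \<noteq> b"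
    and "t < n"
  shows "colorful_helly_number (hamming_space n X) (hamming_balls n X t) = enat (2 ^ (t + 1))"
proof -
  let ?H = "colorful_helly_property (hamming_space n X) (hamming_balls n X t)"
  obtain p q where pq: "p \<in> X" "q \<in> X" "p \<noteq> q" using assms(1) by blast
  have upper: "?H (2 ^ (t + 1))" by (rule colorful_helly_upper[OF pq(1)])
  have "(LEAST k. k > 0 \<and> ?H k) = 2 ^ (t + 1)"
    using upper colorful_helly_lower[OF pq \<open>t < n\<close>] by (intro Least_equality) auto
  moreover have "\<exists>k>0. ?H k" using upper by (intro exI[of _ "2 ^ (t + 1)"]) simp
  ultimately show ?thesis by (simp add: colorful_helly_number_def)
qed

end
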